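(* Consider the equation $\ddot{x}-x+x^3=\varepsilon[(p_1+p_2x-x^2)\dot{x}+p_3\sin(p_4t)]$ with real parameters $p_1,p_2,p_3,p_4$, $p_3\neq 0$, $p_4>0$. Let $H(x,y)=\frac{y^2}{2}-\frac{x^2}{2}+\frac{x^4}{4}$, let $G_1^{\pm}=\{H(x,y)=h:\ h\in(-\tfrac14,0),\ \pm x>0\}$ and $G_2=\{H(x,y)=h:\ h>0\}$ be the three domains filled with closed phase curves of the unperturbed equation ($\varepsilon=0$). Let $V$ be the set obtained from $G_1^{+}\cup G_1^{-}\cup G_2$ by removing a fixed ($\varepsilon$-independent) neighborhood of the "figure-eight" $\{H=0\}$ and fixed neighborhoods of those levels (closed phase curves) in each domain at which the corresponding Poincaré–Pontryagin generating function ($B_1^{\pm}$ in $G_1^{\pm}$, $B_2$ in $G_2$) vanishes. Then there are only finitely many splittable resonance levels in $V$.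
   Context: Unperturbed system: $\dot x=y,\ \dot y=x-x^3$, with first integral $H$. It has centers $(\pm1,0)$ and a saddle $(0,0)$ whose two homoclinic loops form the "figure-eight" $\{H=0\}$. Action–angle variables: in each of the domains $G_1^{+},G_1^{-},G_2$, let $(I,\theta)$ be the canonical action–angle variables of the unperturbed system, $I(h)=\frac{1}{2\pi}\oint_{H=h}y\,dx$, with $\theta$ taken modulo $2\pi$; let $x=x(I,\theta)$, $y=y(I,\theta)$ ($2\pi$-periodic in $\theta$) be the corresponding parametrization of the closed curves, and let $\omega(I)=dh/dI$ be the frequency, so that $\dot I=0,\ \dot\theta=\omega(I)$ along the unperturbed flow. For the perturbed equation, with $\varphi=p_4t$, one has $\dot I=\varepsilon F_1(I,\theta,\varphi)$, where $$F_1(I,\theta,\varphi)=\big[(p_1+p_2x-x^2)y+p_3\sin\varphi\big]\,\frac{\partial x}{\partial\theta},\qquad x=x(I,\theta),\ y=y(I,\theta).$$ Resonance level: for coprime positive integers $p,q$, a level $I=I_{pq}$ (equivalently, the closed phase curve $H=h_{pq}$ of the unperturbed system lying in one of the domains) with $\omega(I_{pq})=\frac{q}{p}\,p_4$. For a resonance level put $$A_0(v,I_{pq})=\frac{1}{2\pi p}\int_0^{2\pi p}F_1\Big(I_{pq},\,v+\frac{q}{p}\varphi,\,\varphi\Big)\,d\varphi .$$ Splittable: the resonance level $I=I_{pq}$ is called splittable if the equation $A_0(v,I_{pq})=0$ has simple roots $v$. Poincaré–Pontryagin generating function: in each domain, it is the function of the level given by $$B(I)=\frac{1}{2\pi}\oint_{H=h(I)}(p_1+p_2x-x^2)\,y\,dx=\frac1{2\pi}\int_0^{2\pi}(p_1+p_2x-x^2)\,y\,\frac{\partial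 x}{\partial\theta}\,d\theta ,$$ the integral being taken along the closed curve in that domain; it is denoted $B_1^{\pm}$ in $G_1^{\pm}$ and $B_2$ in $G_2$. (Its zeros correspond to limit cycles of the autonomous equation with $p_3=0$; each of these functions has at most two zeros in its domain.) *)

theory Defs
  imports "HOL-Analysis.Analysis"
begin

definition H :: "real \<Rightarrow> real \<Rightarrow> real" where
  "H x y = y\<^sup>2 / 2 - x\<^sup>2 / 2 + x ^ 4 / 4"

datatype region = G1_plus | G1_minus | G2

fun energies :: "region \<Rightarrow> real set" where
  "energies G1_plus = {- 1 / 4 <..< 0}"
| "energies G1_minus = {- 1 / 4 <..< 0}"
| "energies G2 = {0 <..}"

fun side :: "region \<Rightarrow> real set" where
  "side G1_plus = {0 <..}"
| "side G1_minus = {..< 0}"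
| "side G2 = UNIV"

definition region_set :: "region \<Rightarrow> (real \<times> real) set" where
  "region_set r = {(x, y). H x y \<in> energies r \<and> x \<in> side r}"

definition level :: "region \<Rightarrow> real \<Rightarrow> (real \<times> real) set" where
  "level r c = {(x, y) \<in> region_set r. H x y = c}"

definition figure_eight :: "(real \<times> real) set" where
  "figure_eight = {(x, y). H x y = 0}"

definition nbhd_of :: "(real \<times> real) set \<Rightarrow> (real \<times> real) set \<Rightarrow> bool" where
  "nbhd_of C N \<longleftrightarrow> C \<subseteq> interior N"

text \<open>Continuous differentiability, in both variables jointly, over \<open>J \<times> \<real>\<close> (\<open>J\<close> open).\<close>

definition C1_over :: "real set \<Rightarrow> (real \<Rightarrow> real \<Rightarrow> real) \<Rightarrow> bool" where
  "C1_over J f \<longleftrightarrow>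
     (\<forall>I\<in>J. \<forall>\<theta>. (\<lambda>(I, \<theta>). f I \<theta>) differentiable (at (I, \<theta>))) \<and>
     continuous_on (J \<times> UNIV) (\<lambda>(I, \<theta>). deriv (\<lambda>i. f i \<theta>) I) \<and>
     continuous_on (J \<times> UNIV) (\<lambda>(I, \<theta>). deriv (f I) \<theta>)"

text \<open>
  Canonical action-angle coordinates on a region: \<open>J\<close> is the range of the action, \<open>h\<close> the energy
  as a function of the action, i.e. the inverse of \<open>I(h) = (1 / 2\<pi>) \<oint> y dx\<close>, and
  \<open>(I, \<theta>) \<mapsto> (X I \<theta>, Y I \<theta>)\<close> is the parametrization of the region. The origin of the angle
  on each level is left free. Since \<open>dx \<and> dy = d\<theta> \<and> dI\<close> (\<open>canonical\<close>) and the energy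
  is \<open>h I\<close>, the Hamiltonian flow \<open>x' = y\<close>, \<open>y' = x - x^3\<close> becomes \<open>I' = 0\<close>, \<open>\<theta>' = dh/dI\<close>.
  Positivity of the action orients the closed curves by this flow: it excludes the pair
  \<open>(- I, - \<theta>)\<close>, which satisfies all the other conditions.
\<close>

locale action_angle =
  fixes r :: region
    and J :: "real set"
    and h :: "real \<Rightarrow> real"
    and X Y :: "real \<Rightarrow> real \<Rightarrow> real"
  assumes open_range: "open J"
    and positive: "J \<subseteq> {0 <..}"
    and energy_bij: "bij_betw h J (energies r)"
    and param_bij:
      "bij_betw (\<lambda>(I, \<theta>). (X I \<theta>, Y I \<theta>)) (J \<times> {0 ..< 2 * pi}) (region_set r)"
    and periodic:
      "I \<in> J \<Longrightarrow> X I (\<theta> + 2 * pi) = X I \<theta>"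
      "I \<in> J \<Longrightarrow> Y I (\<theta> + 2 * pi) = Y I \<theta>"
    and C1: "C1_over J X" "C1_over J Y"
    and canonical:
      "I \<in> J \<Longrightarrow>
         deriv (X I) \<theta> * deriv (\<lambda>i. Y i \<theta>) I - deriv (\<lambda>i. X i \<theta>) I * deriv (Y I) \<theta> = 1"
    and energy: "I \<in> J \<Longrightarrow> H (X I \<theta>) (Y I \<theta>) = h I"
    and action:
      "I \<in> J \<Longrightarrow> I = 1 / (2 * pi) * integral {0 .. 2 * pi} (\<lambda>\<theta>. Y I \<theta> * deriv (X I) \<theta>)"

definition frequency :: "(real \<Rightarrow> real) \<Rightarrow> real \<Rightarrow> real" where
  "frequency h I = deriv h I"

text \<open>
  For \<open>x'' - x + x^3 = \<epsilon> g\<close> with \<open>g = (p1 + p2 x - x^2) x' + p3 sin \<phi>\<close> and \<open>\<phi> = p4 t\<close> one has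
  \<open>I' = \<epsilon> g (\<partial>I/\<partial>y)\<close>, where \<open>\<partial>I/\<partial>y = \<partial>x/\<partial>\<theta>\<close> because the coordinates are canonical.
\<close>

definition F1 ::
  "real \<Rightarrow> real \<Rightarrow> real \<Rightarrow> (real \<Rightarrow> real \<Rightarrow> real) \<Rightarrow> (real \<Rightarrow> real \<Rightarrow> real) \<Rightarrow>
   real \<Rightarrow> real \<Rightarrow> real \<Rightarrow> real" where
  "F1 p1 p2 p3 X Y I \<theta> \<phi> =
     ((p1 + p2 * X I \<theta> - (X I \<theta>)\<^sup>2) * Y I \<theta> + p3 * sin \<phi>) * deriv (X I) \<theta>"

definition A0 ::
  "real \<Rightarrow> real \<Rightarrow> real \<Rightarrow> (real \<Rightarrow> real \<Rightarrow> real) \<Rightarrow> (real \<Rightarrow> real \<Rightarrow> real) \<Rightarrow>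
   nat \<Rightarrow> nat \<Rightarrow> real \<Rightarrow> real \<Rightarrow> real" where
  "A0 p1 p2 p3 X Y p q I v =
     1 / (2 * pi * real p) *
     integral {0 .. 2 * pi * real p}
       (\<lambda>\<phi>. F1 p1 p2 p3 X Y I (v + real q / real p * \<phi>) \<phi>)"

definition generating_function ::
  "real \<Rightarrow> real \<Rightarrow> (real \<Rightarrow> real \<Rightarrow> real) \<Rightarrow> (real \<Rightarrow> real \<Rightarrow> real) \<Rightarrow> real \<Rightarrow> real" where
  "generating_function p1 p2 X Y I =
     1 / (2 * pi) *
     integral {0 .. 2 * pi}
       (\<lambda>\<theta>. (p1 + p2 * X I \<theta> - (X I \<theta>)\<^sup>2) * Y I \<theta> * deriv (X I) \<theta>)"

definition resonant :: "real \<Rightarrow> (real \<Rightarrow> real) \<Rightarrow> nat \<Rightarrow> nat \<Rightarrow> real \<Rightarrow> bool" where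
  "resonant p4 h p q I \<longleftrightarrow>
     0 < p \<and> 0 < q \<and> coprime p q \<and> frequency h I = real q / real p * p4"

definition simple_root :: "(real \<Rightarrow> real) \<Rightarrow> real \<Rightarrow> bool" where
  "simple_root f v \<longleftrightarrow> f v = 0 \<and> (\<exists>D. D \<noteq> 0 \<and> (f has_real_derivative D) (at v))"

definition splittable_resonance ::
  "real \<Rightarrow> real \<Rightarrow> real \<Rightarrow> real \<Rightarrow> (real \<Rightarrow> real) \<Rightarrow>
   (real \<Rightarrow> real \<Rightarrow> real) \<Rightarrow> (real \<Rightarrow> real \<Rightarrow> real) \<Rightarrow> real \<Rightarrow> bool" where
  "splittable_resonance p1 p2 p3 p4 h X Y I \<longleftrightarrow>
     (\<exists>p q. resonant p4 h p q I \<and> (\<exists>v. simple_root (A0 p1 p2 p3 X Y p q I) v))"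

end

theory Submission
  imports Defs
begin

text \<open>
  Along a resonance level \<open>A\<^sub>0(v)\<close> is \<open>B\<close> plus a multiple of the integral of
  \<open>sin \<phi> \<cdot> x\<^sub>\<theta>(v + q\<phi>/p)\<close>. Only the harmonics \<open>k\<close> of \<open>x\<^sub>\<theta>\<close> with
  \<open>k q = p\<close> contribute to it, so for \<open>q > 1\<close> the function \<open>A\<^sub>0\<close> is constant and has no simple roots. Splittable
  levels thus satisfy \<open>\<omega> = p4 / p\<close>. Explicit elliptic integrals for the period show that \<open>\<omega>\<close>
  is strictly monotone in the energy on each domain, so every \<open>p\<close> contributes at most one level
  per domain, and that \<open>\<omega>\<close> is bounded away from \<open>0\<close> off a neighbourhood of the saddle, so only
  finitely many \<open>p\<close> occur.
\<close>

section \<open>Integrals of periodic functions\<close>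

lemma integral_periodic_shift:
  fixes f :: "real \<Rightarrow> real"
  assumes cont: "continuous_on UNIV f" and per: "\<And>x. f (x + T) = f x" and T: "T \<ge> 0"
  shows "integral {0..T} (\<lambda>x. f (x + a)) = integral {0..T} f"
proof -
  \<comment> \<open>For a shift \<open>b >= 0\<close> the interval from \<open>0\<close> to
    \<open>b + T\<close> is split once at \<open>b\<close> and once at \<open>T\<close>; the first
    and the last piece of length \<open>b\<close> have equal integrals by periodicity.\<close>
  have nonneg: "integral {0..T} (\<lambda>x. g (x + b)) = integral {0..T} g"
    if g: "continuous_on UNIV g" "\<And>x. g (x + T) = g x" and b: "b \<ge> 0"
    for g :: "real \<Rightarrow> real" and b
  proof -
    have int: "g integrable_on {c..d}" for c d
      using g(1) by (meson continuous_on_subset integrable_continuous_interval subset_UNIV)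
    have "integral {0..b} g + integral {b..b + T} g = integral {0..b + T} g"
      by (rule Henstock_Kurzweil_Integration.integral_combine) (use b T int in auto)
    moreover have "integral {0..T} g + integral {T..b + T} g = integral {0..b + T} g"
      by (rule Henstock_Kurzweil_Integration.integral_combine) (use b T int in auto)
    moreover have "integral {T..b + T} g = integral {0..b} g"
      using integral_shift_real_ivl[of T T "b + T" g] g(2) by simp
    moreover have "integral {0..T} (\<lambda>x. g (x + b)) = integral {b..b + T} g"
      using integral_shift_real_ivl[of b b "b + T" g] by simp
    ultimately show ?thesis by simp
  qed
  show ?thesis
  proof (cases "a \<ge> 0")
    case True
    then show ?thesis using nonneg cont per by blast
  next
    case False
    \<comment> \<open>A negative shift is undone: the shifted function, moved by \<open>- a\<close>,
      is \<open>f\<close> again, and \<open>- a\<close> falls under the first case.\<close>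
    have c: "continuous_on UNIV (\<lambda>x. f (x + a))"
      by (intro continuous_on_compose2[OF cont] continuous_intros) auto
    have p: "f (x + T + a) = f (x + a)" for x
      using per[of "x + a"] by (simp add: algebra_simps)
    show ?thesis
      using nonneg[of "\<lambda>x. f (x + a)" "- a", OF c p] False by simp
  qed
qed

text \<open>
  Shifting the argument by \<open>\<beta>\<close> multiplies \<open>\<integral> exp (i x) w(x) dx\<close> by the factor
  \<open>exp (- i \<beta>) \<noteq> 1\<close> while leaving it unchanged.
\<close>

lemma integral_sin_periodic_eq_0:
  fixes w :: "real \<Rightarrow> real"
  assumes cont: "continuous_on UNIV w" and per: "\<And>x. w (x + \<beta>) = w x"
    and perT: "\<And>x. w (x + T) = w x" and T: "T \<ge> 0" "sin T = 0" "cos T = 1"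
    and \<beta>: "cos \<beta> \<noteq> 1"
  shows "integral {0..T} (\<lambda>x. sin x * w x) = 0"
proof -
  define S C where "S = integral {0..T} (\<lambda>x. sin x * w x)"
    and "C = integral {0..T} (\<lambda>x. cos x * w x)"
  have cs: "continuous_on UNIV (\<lambda>x. sin x * w x)" and cc: "continuous_on UNIV (\<lambda>x. cos x * w x)"
    by (intro continuous_intros cont)+
  have sint: "(\<lambda>x. sin x * w x) integrable_on {0..T}" and cint: "(\<lambda>x. cos x * w x) integrable_on {0..T}"
    using cs cc by (meson continuous_on_subset integrable_continuous_interval subset_UNIV)+
  have ps: "sin (x + T) * w (x + T) = sin x * w x" and pc: "cos (x + T) * w (x + T) = cos x * w x" for x
    using T by (simp_all add: sin_add cos_add perT)
  have "S = integral {0..T} (\<lambda>x. cos \<beta> * (sin x * w x) + sin \<beta> * (cos x * w x))"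
    unfolding S_def
    by (subst integral_periodic_shift[OF cs ps T(1), of \<beta>, symmetric])
       (simp add: per sin_add algebra_simps)
  also have "\<dots> = cos \<beta> * S + sin \<beta> * C"
    using sint cint unfolding S_def C_def by (simp add: integral_add integrable_on_mult_right)
  finally have 1: "S = cos \<beta> * S + sin \<beta> * C" .
  have "C = integral {0..T} (\<lambda>x. cos \<beta> * (cos x * w x) - sin \<beta> * (sin x * w x))"
    unfolding C_def
    by (subst integral_periodic_shift[OF cc pc T(1), of \<beta>, symmetric])
       (simp add: per cos_add algebra_simps)
  also have "\<dots> = cos \<beta> * C - sin \<beta> * S"
    using sint cint unfolding S_def C_def by (simp add: integral_diff integrable_on_mult_right)
  finally have 2: "C = cos \<beta> * C - sin \<beta> * S" .
  have "S * (1 - cos \<beta>) = sin \<beta> * C" "C * (1 - cos \<beta>) = - sin \<beta> * S"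
    using 1 2 by (simp_all add: algebra_simps)
  \<comment> \<open>Eliminating \<open>C\<close> leaves \<open>S\<close> times the determinant
    \<open>(1 - cos \<beta>)^2 + (sin \<beta>)^2\<close> of the linear system.\<close>
  then have "S * (1 - cos \<beta>)\<^sup>2 = - (sin \<beta>)\<^sup>2 * S"
    by (metis (no_types, lifting) mult.commute mult.left_commute mult_minus_left power2_eq_square)
  then have "S * ((1 - cos \<beta>)\<^sup>2 + (sin \<beta>)\<^sup>2) = 0"
    by (simp add: algebra_simps)
  moreover have "(1 - cos \<beta>)\<^sup>2 + (sin \<beta>)\<^sup>2 > 0"
    using \<beta> by (intro add_pos_nonneg) auto
  ultimately show ?thesis unfolding S_def by auto
qed

section \<open>Uniqueness for the Duffing flow and partial derivatives\<close>

text \<open>Gronwall argument: the squared distance \<open>D\<close> of two solutions has derivative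
  at most \<open>M * D\<close>, so \<open>exp (- M * t) * D t\<close> cannot grow from its initial
  value 0. The common factor \<open>k\<close> is a change of time. Derivatives are asked for only
  inside the interval, so that a time function defined by an integral from \<open>0\<close> can be
  used.\<close>

lemma Duffing_unique:
  fixes x1 y1 x2 y2 k :: "real \<Rightarrow> real"
  assumes cont: "continuous_on {0..T} x1" "continuous_on {0..T} y1"
      "continuous_on {0..T} x2" "continuous_on {0..T} y2" "continuous_on {0..T} k"
    and d: "\<And>t. \<lbrakk>0 < t; t < T\<rbrakk> \<Longrightarrow> (x1 has_real_derivative y1 t * k t) (at t)"
      "\<And>t. \<lbrakk>0 < t; t < T\<rbrakk> \<Longrightarrow> (y1 has_real_derivative (x1 t - x1 t ^ 3) * k t) (at t)"
      "\<And>t. \<lbrakk>0 < t; t < T\<rbrakk> \<Longrightarrow> (x2 has_real_derivative y2 t * k t) (at t)"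
      "\<And>t. \<lbrakk>0 < t; t < T\<rbrakk> \<Longrightarrow> (y2 has_real_derivative (x2 t - x2 t ^ 3) * k t) (at t)"
    and init: "x1 0 = x2 0" "y1 0 = y2 0" and t: "t \<in> {0..T}"
  shows "x1 t = x2 t" "y1 t = y2 t"
proof -
  \<comment> \<open>The factor \<open>m\<close> comes from dividing \<open>x1^3 - x2^3\<close> by
    \<open>x1 - x2\<close>: the derivative of \<open>D\<close> is
    \<open>2 * a * b * m\<close>.\<close>
  define m where "m = (\<lambda>t. k t * (2 - ((x1 t)\<^sup>2 + x1 t * x2 t + (x2 t)\<^sup>2)))"
  have "continuous_on {0..T} m" unfolding m_def by (intro continuous_intros cont)
  then have "compact (m ` {0..T})" by (rule compact_continuous_image) simp
  then obtain M where M: "\<And>t. t \<in> {0..T} \<Longrightarrow> \<bar>m t\<bar> \<le> M"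
    using compact_imp_bounded bounded_iff by (metis imageI real_norm_def)
  define D where "D = (\<lambda>t. (x1 t - x2 t)\<^sup>2 + (y1 t - y2 t)\<^sup>2)"
  define E where "E = (\<lambda>t. exp (- M * t) * D t)"
  have "E t \<le> E 0"
  proof (rule DERIV_nonpos_imp_decreasing_open[where f = E and a = 0 and b = t])
    show "0 \<le> t" using t by simp
    show "continuous_on {0..t} E" unfolding E_def D_def
      by (intro continuous_intros continuous_on_subset[OF cont(1)] continuous_on_subset[OF cont(2)]
        continuous_on_subset[OF cont(3)] continuous_on_subset[OF cont(4)]) (use t in auto)
    fix s assume s: "0 < s" "s < t"
    then have sT: "0 < s" "s < T" using t by auto
    define a b where "a = x1 s - x2 s" and "b = y1 s - y2 s"
    have "(D has_real_derivative 2 * a * b * m s) (at s)"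
      unfolding D_def m_def a_def b_def
      by (rule derivative_eq_intros d sT refl)+
         (simp add: algebra_simps power2_eq_square power3_eq_cube)
    then have E': "(E has_real_derivative exp (- M * s) * (2 * a * b * m s - M * D s)) (at s)"
      unfolding E_def by (auto intro!: derivative_eq_intros simp: algebra_simps)
    have "2 * a * b * m s \<le> \<bar>2 * a * b\<bar> * \<bar>m s\<bar>" by (metis abs_ge_self abs_mult)
    also have "\<dots> \<le> (a\<^sup>2 + b\<^sup>2) * M"
    proof (rule mult_mono)
      show "\<bar>2 * a * b\<bar> \<le> a\<^sup>2 + b\<^sup>2"
        using sum_squares_bound[of a b] sum_squares_bound[of a "- b"] by (simp add: abs_le_iff)
      show "\<bar>m s\<bar> \<le> M" using M sT by auto
    qed auto
    finally have "2 * a * b * m s \<le> M * D s" by (simp add: D_def a_def b_def mult.commute)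
    then show "\<exists>y. DERIV E s :> y \<and> y \<le> 0"
      using E' by (intro exI conjI) (auto simp: mult_le_0_iff)
  qed
  also have "E 0 = 0" by (simp add: E_def D_def init)
  finally have "D t \<le> 0" by (simp add: E_def mult_le_0_iff)
  moreover have "(x1 t - x2 t)\<^sup>2 \<ge> 0" "(y1 t - y2 t)\<^sup>2 \<ge> 0" by simp_all
  ultimately have "(x1 t - x2 t)\<^sup>2 = 0" "(y1 t - y2 t)\<^sup>2 = 0" unfolding D_def by linarith+
  then show "x1 t = x2 t" "y1 t = y2 t" by simp_all
qed

text \<open>The total function \<open>deriv\<close> is meaningful only where a derivative exists;
  joint differentiability, restricted to the two coordinate lines, supplies that existence.\<close>

lemma C1_over_partials:
  assumes "C1_over J f" "I \<in> J"
  shows "(f I has_real_derivative deriv (f I) \<theta>) (at \<theta>)"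
    and "((\<lambda>i. f i \<theta>) has_real_derivative deriv (\<lambda>i. f i \<theta>) I) (at I)"
proof -
  have d: "(\<lambda>(I, \<theta>). f I \<theta>) differentiable (at (I, \<theta>))"
    using assms by (simp add: C1_over_def)
  have "((\<lambda>(I, \<theta>). f I \<theta>) \<circ> Pair I) differentiable (at \<theta>)"
    using differentiable_chain_at[OF differentiableI[OF has_derivative_Pair[OF has_derivative_const has_derivative_ident]] d] .
  then show "(f I has_real_derivative deriv (f I) \<theta>) (at \<theta>)"
    unfolding DERIV_deriv_iff_real_differentiable by (simp add: o_def)
  have "((\<lambda>(I, \<theta>). f I \<theta>) \<circ> (\<lambda>i. (i, \<theta>))) differentiable (at I)"
    using differentiable_chain_at[OF differentiableI[OF has_derivative_Pair[OF has_derivative_ident has_derivative_const]] d] .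
  then show "((\<lambda>i. f i \<theta>) has_real_derivative deriv (\<lambda>i. f i \<theta>) I) (at I)"
    unfolding DERIV_deriv_iff_real_differentiable by (simp add: o_def)
qed

lemma DERIV_H:
  assumes "(f has_real_derivative f') (at t)" "(g has_real_derivative g') (at t)"
  shows "((\<lambda>t. H (f t) (g t)) has_real_derivative (f t ^ 3 - f t) * f' + g t * g') (at t)"
  unfolding H_def
  by (auto intro!: derivative_eq_intros assms simp: algebra_simps power3_eq_cube power2_eq_square)

section \<open>Period functions of the unperturbed flow\<close>

text \<open>
  The period of the level \<open>H = (s\<^sup>2 - 1) / 4\<close>. Inside the loops the level is parametrized by
  \<open>x\<^sup>2 = 1 - s cos \<alpha>\<close>, outside by \<open>x = sqrt (1 + s) sin \<psi>\<close>; the integrands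
  are \<open>dt/d\<alpha>\<close> and \<open>dt/d\<psi>\<close>.
\<close>

definition inner_period :: "real \<Rightarrow> real" where
  "inner_period s = integral {0..2 * pi} (\<lambda>\<alpha>. 1 / sqrt (2 * (1 - s * cos \<alpha>)))"

definition outer_period :: "real \<Rightarrow> real" where
  "outer_period s = integral {0..2 * pi} (\<lambda>\<psi>. 1 / sqrt (((1 + s) * (sin \<psi>)\<^sup>2 + s - 1) / 2))"

lemma cos_eq_1_imp_0:
  assumes "cos t = 1" "0 \<le> t" "t < 2 * pi"
  shows "t = 0"
proof -
  obtain n :: int where n: "t = of_int n * 2 * pi" using assms(1) unfolding cos_one_2pi_int by blast
  have "0 \<le> of_int n * (2 * pi)" "of_int n * (2 * pi) < 1 * (2 * pi)" using assms n by simp_all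
  then have "0 \<le> real_of_int n" "real_of_int n < 1"
    using pi_gt_zero by (simp_all only: zero_le_mult_iff mult_less_cancel_right) linarith+
  then show ?thesis using n by simp
qed

lemma mult_cos_less_1: "\<bar>s\<bar> < 1 \<Longrightarrow> s * cos \<alpha> < (1 :: real)"
  using mult_left_mono[OF abs_cos_le_one[of \<alpha>], of "\<bar>s\<bar>"] abs_ge_self[of "s * cos \<alpha>"]
  by (simp add: abs_mult)

text \<open>The square of the sum is \<open>1 / (1 - z^2) + 1 / sqrt (1 - z^2)\<close>, in which
  both terms increase with \<open>z^2\<close>.\<close>

lemma sum_inverse_sqrt_mono:
  fixes z z' :: real
  assumes "z\<^sup>2 \<le> z'\<^sup>2" "z'\<^sup>2 < 1"
  shows "1 / sqrt (2 * (1 - z)) + 1 / sqrt (2 * (1 + z)) \<le> 1 / sqrt (2 * (1 - z')) + 1 / sqrt (2 * (1 + z'))"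
    and "z\<^sup>2 < z'\<^sup>2 \<Longrightarrow>
      1 / sqrt (2 * (1 - z)) + 1 / sqrt (2 * (1 + z)) < 1 / sqrt (2 * (1 - z')) + 1 / sqrt (2 * (1 + z'))"
proof -
  have eq: "1 / sqrt (2 * (1 - z)) + 1 / sqrt (2 * (1 + z)) = sqrt (1 / (1 - z\<^sup>2) + 1 / sqrt (1 - z\<^sup>2))"
    if "z\<^sup>2 < 1" for z :: real
  proof -
    have z: "1 - z > 0" "1 + z > 0" using that by (auto simp: abs_square_less_1)
    define a b where "a = sqrt (2 * (1 - z))" and "b = sqrt (2 * (1 + z))"
    have ab: "a > 0" "b > 0" "a\<^sup>2 = 2 * (1 - z)" "b\<^sup>2 = 2 * (1 + z)" using z by (simp_all add: a_def b_def)
    have "a * b = sqrt (4 * (1 - z\<^sup>2))"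
      unfolding a_def b_def real_sqrt_mult[symmetric] by (simp add: algebra_simps power2_eq_square)
    then have prod: "a * b = 2 * sqrt (1 - z\<^sup>2)" by (simp only: real_sqrt_mult real_sqrt_four)
    have "(1 / a + 1 / b)\<^sup>2 = 1 / a\<^sup>2 + 1 / b\<^sup>2 + 2 / (a * b)"
      by (simp add: power2_sum power_divide)
    also have "\<dots> = 1 / (2 * (1 - z)) + 1 / (2 * (1 + z)) + 1 / sqrt (1 - z\<^sup>2)"
      by (simp add: ab prod)
    also have "1 / (2 * (1 - z)) + 1 / (2 * (1 + z)) = 1 / ((1 - z) * (1 + z))"
      using z by (simp add: divide_simps) (simp add: algebra_simps)
    also have "(1 - z) * (1 + z) = 1 - z\<^sup>2" by (simp add: algebra_simps power2_eq_square)
    finally show ?thesis using ab unfolding a_def[symmetric] b_def[symmetric]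
      by (intro real_sqrt_unique[symmetric]) auto
  qed
  have z: "z\<^sup>2 < 1" using assms by simp
  show "1 / sqrt (2 * (1 - z)) + 1 / sqrt (2 * (1 + z)) \<le> 1 / sqrt (2 * (1 - z')) + 1 / sqrt (2 * (1 + z'))"
    unfolding eq[OF z] eq[OF assms(2)] real_sqrt_le_iff
    by (intro add_mono divide_left_mono) (use assms z in auto)
  assume lt: "z\<^sup>2 < z'\<^sup>2"
  show "1 / sqrt (2 * (1 - z)) + 1 / sqrt (2 * (1 + z)) < 1 / sqrt (2 * (1 - z')) + 1 / sqrt (2 * (1 + z'))"
    unfolding eq[OF z] eq[OF assms(2)] real_sqrt_less_iff
    by (intro add_strict_mono divide_strict_left_mono) (use assms z lt in auto)
qed

text \<open>Averaging over \<open>\<alpha>\<close> and \<open>\<alpha> + \<pi>\<close> makes the integrand monotone in \<open>s\<close> pointwise.\<close>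

lemma inner_period_strict_mono:
  assumes s: "0 \<le> s" "s < s'" "s' < 1"
  shows "inner_period s < inner_period s'"
proof -
  define f where "f = (\<lambda>s \<alpha>. 1 / sqrt (2 * (1 - s * cos \<alpha>)) :: real)"
  define k where "k = (\<lambda>s \<alpha>. 1 / sqrt (2 * (1 - s * cos \<alpha>)) + 1 / sqrt (2 * (1 + s * cos \<alpha>)) :: real)"
  have cf: "continuous_on A (f s)" if "\<bar>s\<bar> < 1" for s A
    unfolding f_def
    by (intro continuous_intros) (use mult_cos_less_1[OF that] in \<open>auto simp: less_imp_neq\<close>)
  have k: "k s = (\<lambda>\<alpha>. f s \<alpha> + f (- s) \<alpha>)" for s by (simp add: k_def f_def)
  have ck: "continuous_on A (k s)" if "\<bar>s\<bar> < 1" for s A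
    unfolding k by (intro continuous_intros cf) (use that in auto)
  \<comment> \<open>Replacing \<open>s\<close> by \<open>- s\<close> amounts to shifting \<alpha> by
    \<pi>, so both summands of \<open>k\<close> have the same integral.\<close>
  have sym: "integral {0..2 * pi} (k s) = 2 * inner_period s" if "\<bar>s\<bar> < 1" for s
  proof -
    have "integral {0..2 * pi} (f (- s)) = integral {0..2 * pi} (\<lambda>\<alpha>. f s (\<alpha> + pi))"
      by (simp add: f_def)
    also have "\<dots> = integral {0..2 * pi} (f s)"
      by (rule integral_periodic_shift[OF cf[OF that]]) (auto simp: f_def)
    finally have "integral {0..2 * pi} (f (- s)) = integral {0..2 * pi} (f s)" .
    moreover have "integral {0..2 * pi} (k s) = integral {0..2 * pi} (f s) + integral {0..2 * pi} (f (- s))"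
      unfolding k by (intro integral_add integrable_continuous_interval cf) (use that in auto)
    ultimately show ?thesis by (simp add: inner_period_def f_def)
  qed
  have sq: "(s * cos \<alpha>)\<^sup>2 \<le> (s' * cos \<alpha>)\<^sup>2" "(s' * cos \<alpha>)\<^sup>2 < 1" for \<alpha>
  proof -
    show "(s * cos \<alpha>)\<^sup>2 \<le> (s' * cos \<alpha>)\<^sup>2"
      unfolding power_mult_distrib by (intro mult_right_mono power_mono) (use s in auto)
    show "(s' * cos \<alpha>)\<^sup>2 < 1"
      using mult_cos_less_1[of s' \<alpha>] mult_cos_less_1[of "- s'" \<alpha>] s by (simp add: abs_square_less_1)
  qed
  have le: "k s \<alpha> \<le> k s' \<alpha>" for \<alpha>
    unfolding k_def by (rule sum_inverse_sqrt_mono(1)[OF sq])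
  \<comment> \<open>One point of strict inequality is enough: a nonnegative continuous function with
    integral 0 vanishes on the whole interval.\<close>
  have lt: "k s 0 < k s' 0"
    unfolding k_def by (rule sum_inverse_sqrt_mono(2)[OF sq]) (use s in \<open>auto intro: power_strict_mono\<close>)
  have abs: "\<bar>s\<bar> < 1" "\<bar>s'\<bar> < 1" using s by auto
  have int: "k s integrable_on {0..2 * pi}" "k s' integrable_on {0..2 * pi}"
    by (intro integrable_continuous_interval ck abs)+
  have "integral {0..2 * pi} (\<lambda>\<alpha>. k s' \<alpha> - k s \<alpha>) \<noteq> 0"
    by (subst integral_eq_0_iff) (use le lt in \<open>auto intro!: continuous_intros ck abs bexI[of _ 0]\<close>)
  moreover have "integral {0..2 * pi} (\<lambda>\<alpha>. k s' \<alpha> - k s \<alpha>) = 2 * inner_period s' - 2 * inner_period s"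
    using int by (simp add: integral_diff sym abs)
  moreover have "integral {0..2 * pi} (k s) \<le> integral {0..2 * pi} (k s')"
    using int le by (intro integral_le)
  ultimately show ?thesis by (simp add: sym abs)
qed

lemma outer_radicand_ge:
  "s > 1 \<Longrightarrow> (s - 1) / 2 \<le> ((1 + s) * (sin \<psi>)\<^sup>2 + s - 1) / (2 :: real)"
  by (simp add: divide_right_mono)

lemma outer_radicand_pos:
  fixes s :: real
  assumes "s > 1"
  shows "((1 + s) * (sin \<psi>)\<^sup>2 + s - 1) / 2 > 0"
proof -
  have "0 < (s - 1) / 2" using assms by simp
  also have "\<dots> \<le> ((1 + s) * (sin \<psi>)\<^sup>2 + s - 1) / 2" by (rule outer_radicand_ge[OF assms])
  finally show ?thesis .
qed

text \<open>Here no averaging occurs: the radicand itself increases with \<open>s\<close> at every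
  \<psi>.\<close>

lemma outer_period_strict_antimono:
  assumes s: "1 < s" "s < s'"
  shows "outer_period s' < outer_period s"
proof -
  note pos = outer_radicand_pos
  have c: "continuous_on A (\<lambda>\<psi>. 1 / sqrt (((1 + s) * (sin \<psi>)\<^sup>2 + s - 1) / 2))" if "s > 1" for A and s :: real
    by (intro continuous_intros) (use pos[OF that] in \<open>auto simp: less_imp_neq[symmetric]\<close>)
  show ?thesis unfolding outer_period_def
  proof (rule integral_less_real)
    fix \<psi> :: real
    have "(1 + s) * (sin \<psi>)\<^sup>2 \<le> (1 + s') * (sin \<psi>)\<^sup>2" using s by (intro mult_right_mono) auto
    then have "((1 + s) * (sin \<psi>)\<^sup>2 + s - 1) / 2 < ((1 + s') * (sin \<psi>)\<^sup>2 + s' - 1) / 2" using s by simp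
    then have "sqrt (((1 + s) * (sin \<psi>)\<^sup>2 + s - 1) / 2) < sqrt (((1 + s') * (sin \<psi>)\<^sup>2 + s' - 1) / 2)"
      by (simp only: real_sqrt_less_iff)
    then show "1 / sqrt (((1 + s') * (sin \<psi>)\<^sup>2 + s' - 1) / 2) < 1 / sqrt (((1 + s) * (sin \<psi>)\<^sup>2 + s - 1) / 2)"
      using pos[of s \<psi>] pos[of s' \<psi>] s by (intro divide_strict_left_mono mult_pos_pos) auto
  qed (use s c pi_gt_zero in \<open>auto simp del: pi_gt_zero\<close>)
qed

text \<open>Gives an upper bound on a period, turned later into a lower bound on the
  frequency.\<close>

lemma integral_inverse_le:
  fixes g :: "real \<Rightarrow> real"
  assumes "continuous_on {0..2 * pi} g" "\<And>t. g t \<ge> c" "c > 0"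
  shows "integral {0..2 * pi} (\<lambda>t. 1 / g t) \<le> 2 * pi / c"
proof -
  have g: "g t > 0" for t using assms(2)[of t] assms(3) by linarith
  have "integral {0..2 * pi} (\<lambda>t. 1 / g t) \<le> integral {0..2 * pi} (\<lambda>t. 1 / c)"
    by (intro integral_le integrable_continuous_interval continuous_intros assms(1))
       (use assms g in \<open>auto simp: less_imp_neq[symmetric] intro!: divide_left_mono\<close>)
  then show ?thesis by simp
qed

section \<open>Hamilton's equations and the geometry of action-angle coordinates\<close>

context action_angle
begin

lemma deriv_theta:
  assumes "I \<in> J"
  shows "(X I has_real_derivative deriv (X I) \<theta>) (at \<theta>)"
    "(Y I has_real_derivative deriv (Y I) \<theta>) (at \<theta>)"
  using C1_over_partials C1 assms by blast+

text \<open>Differentiating the energy relation in the angle and in the action gives two linear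
  relations; since the Jacobian is 1, Cramer's rule solves them.\<close>

lemma Hamilton_equations:
  assumes I: "I \<in> J"
  shows "deriv h I * deriv (X I) \<theta> = Y I \<theta>"
    "deriv h I * deriv (Y I) \<theta> = X I \<theta> - X I \<theta> ^ 3"
proof -
  define x y xt yt xi yi where "x = X I \<theta>" and "y = Y I \<theta>" and "xt = deriv (X I) \<theta>"
    and "yt = deriv (Y I) \<theta>" and "xi = deriv (\<lambda>i. X i \<theta>) I" and "yi = deriv (\<lambda>i. Y i \<theta>) I"
  note defs = this
  have dX: "((\<lambda>i. X i \<theta>) has_real_derivative xi) (at I)"
    and dY: "((\<lambda>i. Y i \<theta>) has_real_derivative yi) (at I)"
    unfolding defs using C1_over_partials(2) C1 I by blast+
  have "((\<lambda>i. H (X i \<theta>) (Y i \<theta>)) has_real_derivative (x ^ 3 - x) * xi + y * yi) (at I)"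
    using DERIV_H[OF dX dY] by (simp add: defs)
  \<comment> \<open>Differentiability of \<open>h\<close> is derived, not assumed: near
    \<open>I\<close> it agrees with \<open>H\<close> along the parametrization.\<close>
  moreover have "eventually (\<lambda>i. H (X i \<theta>) (Y i \<theta>) = h i) (nhds I)"
    using eventually_nhds_in_open[OF open_range I] by eventually_elim (rule energy)
  ultimately have "(h has_real_derivative (x ^ 3 - x) * xi + y * yi) (at I)"
    by (subst (asm) DERIV_cong_ev[OF refl _ refl])
  then have e1: "deriv h I = (x ^ 3 - x) * xi + y * yi" by (rule DERIV_imp_deriv)
  have "((\<lambda>\<theta>. H (X I \<theta>) (Y I \<theta>)) has_real_derivative (x ^ 3 - x) * xt + y * yt) (at \<theta>)"
    using DERIV_H[OF deriv_theta[OF I]] by (simp add: defs)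
  moreover have "(\<lambda>\<theta>. H (X I \<theta>) (Y I \<theta>)) = (\<lambda>_. h I)" using energy[OF I] by auto
  ultimately have "((\<lambda>_::real. h I) has_real_derivative (x ^ 3 - x) * xt + y * yt) (at \<theta>)" by simp
  then have e2: "(x ^ 3 - x) * xt + y * yt = 0" using DERIV_unique DERIV_const by blast
  have e3: "xt * yi - xi * yt = 1" using canonical[OF I] by (simp add: defs)
  have "deriv h I * xt = y * (xt * yi - xi * yt) + xi * ((x ^ 3 - x) * xt + y * yt)"
    unfolding e1 by algebra
  then show "deriv h I * deriv (X I) \<theta> = Y I \<theta>" using e2 e3 by (simp add: defs)
  have "deriv h I * yt = (x - x ^ 3) * (xt * yi - xi * yt) + yi * ((x ^ 3 - x) * xt + y * yt)"
    unfolding e1 by algebra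
  then show "deriv h I * deriv (Y I) \<theta> = X I \<theta> - X I \<theta> ^ 3" using e2 e3 by (simp add: defs)
qed

lemma periodic_nat:
  assumes "I \<in> J"
  shows "X I (\<theta> + 2 * pi * real n) = X I \<theta>" "Y I (\<theta> + 2 * pi * real n) = Y I \<theta>"
proof -
  have "X I (\<theta> + 2 * pi * real n) = X I \<theta> \<and> Y I (\<theta> + 2 * pi * real n) = Y I \<theta>"
  proof (induction n)
    case (Suc n)
    then show ?case
      using periodic[OF assms, of "\<theta> + 2 * pi * real n"] by (simp add: algebra_simps)
  qed simp
  then show "X I (\<theta> + 2 * pi * real n) = X I \<theta>" "Y I (\<theta> + 2 * pi * real n) = Y I \<theta>" by auto
qed

lemma periodic_int:
  assumes "I \<in> J"
  shows "X I (\<theta> + 2 * pi * of_int n) = X I \<theta>" "Y I (\<theta> + 2 * pi * of_int n) = Y I \<theta>"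
proof -
  have "X I (\<theta> + 2 * pi * of_int n) = X I \<theta> \<and> Y I (\<theta> + 2 * pi * of_int n) = Y I \<theta>"
  proof (cases n)
    case (nonneg k)
    then show ?thesis using periodic_nat[OF assms, of \<theta> k] by simp
  next
    case (neg k)
    then have "real_of_int n = - real (Suc k)" by simp
    then have "\<theta> + 2 * pi * of_int n + 2 * pi * real (Suc k) = \<theta>"
      by (simp del: of_nat_Suc)
    then show ?thesis
      using periodic_nat[OF assms, of "\<theta> + 2 * pi * of_int n" "Suc k"] by metis
  qed
  then show "X I (\<theta> + 2 * pi * of_int n) = X I \<theta>" "Y I (\<theta> + 2 * pi * of_int n) = Y I \<theta>" by auto
qed

lemma reduce_angle:
  obtains n :: int and \<theta>' where "\<theta> = \<theta>' + 2 * pi * of_int n" "\<theta>' \<in> {0..<2 * pi}"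
proof
  let ?n = "\<lfloor>\<theta> / (2 * pi)\<rfloor>"
  show "\<theta> = (\<theta> - 2 * pi * of_int ?n) + 2 * pi * of_int ?n" by simp
  show "\<theta> - 2 * pi * of_int ?n \<in> {0..<2 * pi}"
    using floor_divide_lower[of "2 * pi" \<theta>] floor_divide_upper[of "2 * pi" \<theta>]
    by (simp add: algebra_simps)
qed

lemma point_in_region:
  assumes "I \<in> J"
  shows "(X I \<theta>, Y I \<theta>) \<in> region_set r"
proof -
  obtain n \<theta>' where n: "\<theta> = \<theta>' + 2 * pi * of_int n" "\<theta>' \<in> {0..<2 * pi}" by (rule reduce_angle)
  have "(X I \<theta>', Y I \<theta>') \<in> region_set r"
    using bij_betw_apply[OF param_bij, of "(I, \<theta>')"] n assms by auto
  then show ?thesis using periodic_int[OF assms] n by simp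
qed

lemma angle_eq:
  assumes I: "I \<in> J" and "X I \<theta>1 = X I \<theta>2" "Y I \<theta>1 = Y I \<theta>2"
  obtains n :: int where "\<theta>1 = \<theta>2 + 2 * pi * of_int n"
proof -
  obtain n1 t1 where 1: "\<theta>1 = t1 + 2 * pi * of_int n1" "t1 \<in> {0..<2 * pi}" by (rule reduce_angle)
  obtain n2 t2 where 2: "\<theta>2 = t2 + 2 * pi * of_int n2" "t2 \<in> {0..<2 * pi}" by (rule reduce_angle)
  have "(X I t1, Y I t1) = (X I t2, Y I t2)" using assms 1 2 periodic_int[OF I] by simp
  then have "t1 = t2" using inj_onD[OF bij_betw_imp_inj_on[OF param_bij], of "(I, t1)" "(I, t2)"] I 1 2 by auto
  then have "\<theta>1 = \<theta>2 + 2 * pi * of_int (n1 - n2)" using 1 2 by (simp add: algebra_simps)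
  then show ?thesis using that by blast
qed

text \<open>The bijection onto the region yields a point with some action \<open>I'\<close>;
  injectivity of the energy forces \<open>I' = I\<close>.\<close>

lemma point_on_level:
  assumes I: "I \<in> J" and "x \<in> side r" "H x y = h I"
  obtains \<theta> where "X I \<theta> = x" "Y I \<theta> = y"
proof -
  have "(x, y) \<in> region_set r"
    using assms bij_betw_apply[OF energy_bij I] by (auto simp: region_set_def)
  then obtain I' \<theta> where I': "I' \<in> J" "X I' \<theta> = x" "Y I' \<theta> = y"
    using bij_betw_imp_surj_on[OF param_bij] by force
  then have "h I' = h I" using energy assms by metis
  then have "I' = I" using bij_betw_imp_inj_on[OF energy_bij] I I' by (auto dest: inj_onD)
  then show ?thesis using that I' by blast
qed

lemma continuous_coords:
  assumes "I \<in> J"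
  shows "continuous_on UNIV (X I)" "continuous_on UNIV (Y I)"
  using deriv_theta[OF assms] by (auto intro!: continuous_at_imp_continuous_on DERIV_isCont)

text \<open>At frequency 0 a point of the level would be an equilibrium, but the saddle and the
  centers lie in none of the regions. The sign comes from positivity of the action: the frequency
  times \<open>2 * pi * I\<close> is the integral of the square of \<open>Y I\<close>.\<close>

lemma frequency_pos:
  assumes I: "I \<in> J"
  shows "deriv h I > 0"
proof -
  have "deriv h I \<noteq> 0"
  proof
    assume "deriv h I = 0"
    then have "Y I 0 = 0" "X I 0 - X I 0 ^ 3 = 0" using Hamilton_equations[OF I, of 0] by auto
    moreover have "X I 0 - X I 0 ^ 3 = X I 0 * (1 - X I 0) * (1 + X I 0)"
      by (simp add: algebra_simps power3_eq_cube)
    ultimately have "Y I 0 = 0" "X I 0 = 0 \<or> X I 0 = 1 \<or> X I 0 = - 1" by auto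
    then have "H (X I 0) (Y I 0) = 0 \<and> X I 0 = 0 \<or> H (X I 0) (Y I 0) = - 1 / 4" by (auto simp: H_def)
    then show False using point_in_region[OF I, of 0] by (cases r) (auto simp: region_set_def)
  qed
  moreover have "deriv h I \<ge> 0"
  proof -
    have "deriv h I * (2 * pi * I) = integral {0..2 * pi} (\<lambda>\<theta>. deriv h I * (Y I \<theta> * deriv (X I) \<theta>))"
      by (subst action[OF I]) simp
    also have "\<dots> = integral {0..2 * pi} (\<lambda>\<theta>. (Y I \<theta>)\<^sup>2)"
      by (intro integral_cong) (use Hamilton_equations[OF I] in \<open>simp add: power2_eq_square mult.left_commute\<close>)
    also have "\<dots> \<ge> 0"
      by (intro integral_nonneg integrable_continuous_interval continuous_intros
            continuous_on_subset[OF continuous_coords(2)[OF I]]) auto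
    finally have "0 \<le> deriv h I * (2 * pi * I)" .
    moreover have "2 * pi * I > 0" using positive I by auto
    ultimately show ?thesis by (simp only: zero_le_mult_iff) linarith
  qed
  ultimately show ?thesis by simp
qed

lemma deriv_X_eq:
  assumes "I \<in> J"
  shows "deriv (X I) \<theta> = Y I \<theta> / deriv h I"
  using Hamilton_equations(1)[OF assms, of \<theta>] frequency_pos[OF assms] by (simp add: field_simps)

lemma deriv_Y_eq:
  assumes "I \<in> J"
  shows "deriv (Y I) \<theta> = (X I \<theta> - X I \<theta> ^ 3) / deriv h I"
  using Hamilton_equations(2)[OF assms, of \<theta>] frequency_pos[OF assms] by (simp add: field_simps)

text \<open>
  \<open>(u, v)\<close> and \<open>(X I, Y I)\<close> after the time change \<open>dt = d\<psi> / g\<close> solve the same initial value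
  problem; comparing their first returns identifies the two periods.
\<close>

lemma frequency_eq_period:
  assumes I: "I \<in> J" and g: "continuous_on UNIV g" "\<And>t. g t > 0"
    and u: "\<And>t. (u has_real_derivative v t / g t) (at t)"
    and v: "\<And>t. (v has_real_derivative (u t - u t ^ 3) / g t) (at t)"
    and init: "u 0 \<in> side r" "H (u 0) (v 0) = h I"
    and per: "u (2 * pi) = u 0" "v (2 * pi) = v 0"
    and minimal: "\<And>t. \<lbrakk>0 \<le> t; t < 2 * pi; u t = u 0; v t = v 0\<rbrakk> \<Longrightarrow> t = 0"
  shows "deriv h I * integral {0..2 * pi} (\<lambda>t. 1 / g t) = 2 * pi"
proof -
  obtain \<theta>0 where \<theta>0: "X I \<theta>0 = u 0" "Y I \<theta>0 = v 0" using point_on_level[OF I init] .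
  define w where "w = deriv h I"
  have w: "w > 0" unfolding w_def using frequency_pos[OF I] .
  \<comment> \<open>\<open>\<tau> t\<close> is the time in which the flow reaches parameter
    \<open>t\<close>; meanwhile the angle advances by \<open>w * \<tau> t\<close>.\<close>
  define \<tau> where "\<tau> = (\<lambda>t. integral {0..t} (\<lambda>t. 1 / g t))"
  have ck: "continuous_on {0..2 * pi} (\<lambda>t. 1 / g t)"
    by (intro continuous_intros continuous_on_subset[OF g(1)]) (use g(2) in \<open>auto simp: less_imp_neq[symmetric]\<close>)
  have d\<tau>0: "(\<tau> has_real_derivative 1 / g t) (at t within {0..2 * pi})" if "t \<in> {0..2 * pi}" for t
    unfolding \<tau>_def by (rule integral_has_real_derivative[OF ck that])
  then have c\<tau>: "continuous_on {0..2 * pi} \<tau>" by (rule DERIV_continuous_on)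
  have d\<tau>: "(\<tau> has_real_derivative 1 / g t) (at t)" if "0 < t" "t < 2 * pi" for t
    using d\<tau>0[of t] that by (simp add: at_within_Icc_at)
  have \<tau>0: "\<tau> 0 = 0" by (simp add: \<tau>_def)
  have \<tau>pos: "\<tau> (2 * pi) > 0"
  proof -
    have "\<tau> 0 < \<tau> (2 * pi)"
    proof (rule DERIV_pos_imp_increasing_open[OF _ _ c\<tau>])
      fix t :: real
      assume "0 < t" "t < 2 * pi"
      then have "DERIV \<tau> t :> 1 / g t" "1 / g t > 0" using d\<tau> g(2) by simp_all
      then show "\<exists>y. DERIV \<tau> t :> y \<and> y > 0" by blast
    qed simp
    then show ?thesis by (simp only: \<tau>0)
  qed
  have eq: "u t = X I (\<theta>0 + w * \<tau> t) \<and> v t = Y I (\<theta>0 + w * \<tau> t)" if t: "t \<in> {0..2 * pi}" for t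
  proof -
    have cu: "continuous_on {0..2 * pi} u" "continuous_on {0..2 * pi} v"
      using u v by (auto intro!: continuous_at_imp_continuous_on DERIV_isCont)
    have cX: "continuous_on {0..2 * pi} (\<lambda>t. X I (\<theta>0 + w * \<tau> t))"
        "continuous_on {0..2 * pi} (\<lambda>t. Y I (\<theta>0 + w * \<tau> t))"
      by (intro continuous_on_compose2[OF continuous_coords(1)[OF I]]
          continuous_on_compose2[OF continuous_coords(2)[OF I]] continuous_intros c\<tau>; simp)+
    have dX: "((\<lambda>t. X I (\<theta>0 + w * \<tau> t)) has_real_derivative Y I (\<theta>0 + w * \<tau> t) * (1 / g t)) (at t)"
      "((\<lambda>t. Y I (\<theta>0 + w * \<tau> t)) has_real_derivative
         (X I (\<theta>0 + w * \<tau> t) - X I (\<theta>0 + w * \<tau> t) ^ 3) * (1 / g t)) (at t)"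
      if "0 < t" "t < 2 * pi" for t
    proof -
      have d: "((\<lambda>t. \<theta>0 + w * \<tau> t) has_real_derivative w * (1 / g t)) (at t)"
        using d\<tau>[OF that] by (auto intro!: derivative_eq_intros)
      show "((\<lambda>t. X I (\<theta>0 + w * \<tau> t)) has_real_derivative Y I (\<theta>0 + w * \<tau> t) * (1 / g t)) (at t)"
        using DERIV_chain2[OF deriv_theta(1)[OF I] d] w deriv_X_eq[OF I] by (simp add: w_def)
      show "((\<lambda>t. Y I (\<theta>0 + w * \<tau> t)) has_real_derivative
         (X I (\<theta>0 + w * \<tau> t) - X I (\<theta>0 + w * \<tau> t) ^ 3) * (1 / g t)) (at t)"
        using DERIV_chain2[OF deriv_theta(2)[OF I] d] w deriv_Y_eq[OF I] by (simp add: w_def)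
    qed
    show ?thesis
      using Duffing_unique[OF cu cX ck _ _ dX _ _ t] u v \<theta>0 \<tau>0 by simp
  qed
  have "X I (\<theta>0 + w * \<tau> (2 * pi)) = X I \<theta>0" "Y I (\<theta>0 + w * \<tau> (2 * pi)) = Y I \<theta>0"
    using eq[of "2 * pi"] per \<theta>0 by simp_all
  then obtain n :: int where "\<theta>0 + w * \<tau> (2 * pi) = \<theta>0 + 2 * pi * of_int n"
    by (rule angle_eq[OF I])
  then have n: "w * \<tau> (2 * pi) = 2 * pi * of_int n" by simp
  have "n > 0"
  proof -
    have "2 * pi * of_int n > 0" unfolding n[symmetric] using w \<tau>pos by simp
    then show ?thesis by (simp add: zero_less_mult_iff)
  qed
  \<comment> \<open>For \<open>n > 1\<close> the intermediate value theorem finds a full turn of the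
    angle before parameter \<open>2 * pi\<close>, an earlier return that contradicts
    \<open>minimal\<close>.\<close>
  moreover have "\<not> n > 1"
  proof
    assume "n > 1"
    then have "2 * pi < w * \<tau> (2 * pi)" unfolding n by simp
    then have lt: "2 * pi / w < \<tau> (2 * pi)" using w by (simp add: field_simps)
    then obtain t where t: "0 \<le> t" "t \<le> 2 * pi" "\<tau> t = 2 * pi / w"
      using IVT'[of \<tau> 0 "2 * pi / w" "2 * pi"] c\<tau> \<tau>0 w by auto
    have "w * \<tau> t = 2 * pi" using t w by simp
    then have "u t = u 0" "v t = v 0" using eq[of t] t \<theta>0 periodic[OF I, of \<theta>0] by simp_all
    moreover have "t < 2 * pi" using t lt by (cases "t = 2 * pi") auto
    ultimately have "t = 0" using minimal t by blast
    then show False using t \<tau>0 w by simp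
  qed
  ultimately have "n = 1" by simp
  then show ?thesis using n by (simp add: \<tau>_def w_def)
qed

section \<open>The averaged function at resonances\<close>

text \<open>The \<open>p3\<close> term vanishes because the factor multiplying the sine has period
  \<open>2 * pi * p / q\<close> in \<phi>, which is not a multiple of \<open>2 * pi\<close>. The
  other term is an integral over a full period, so the phase \<open>v\<close> drops out.\<close>

lemma A0_constant:
  assumes I: "I \<in> J" and p: "p > 0" and q: "q > 1" and cop: "coprime p q"
  shows "A0 p1 p2 p3 X Y p q I v = A0 p1 p2 p3 X Y p q I 0"
proof -
  define P where "P = (\<lambda>\<theta>. (p1 + p2 * X I \<theta> - (X I \<theta>)\<^sup>2) * Y I \<theta> * deriv (X I) \<theta>)"
  define c T where "c = real q / real p" and "T = 2 * pi * real p"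
  have c: "c > 0" and T: "T \<ge> 0" using p q by (auto simp: c_def T_def)
  have dX: "deriv (X I) = (\<lambda>\<theta>. Y I \<theta> / deriv h I)" using deriv_X_eq[OF I] by auto
  note cX = continuous_coords[OF I, THEN continuous_on_compose2]
  have per: "X I (v + c * (x + T)) = X I (v + c * x)" "Y I (v + c * (x + T)) = Y I (v + c * x)" for v x
  proof -
    have "v + c * (x + T) = v + c * x + 2 * pi * real q"
      using p by (simp add: c_def T_def field_simps)
    then show "X I (v + c * (x + T)) = X I (v + c * x)" "Y I (v + c * (x + T)) = Y I (v + c * x)"
      using periodic_nat[OF I] by metis+
  qed
  define \<beta> where "\<beta> = 2 * pi * real p / real q"
  have per': "Y I (v + c * (x + \<beta>)) = Y I (v + c * x)" for v x
  proof -
    have "v + c * (x + \<beta>) = v + c * x + 2 * pi"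
      using p q by (simp add: c_def \<beta>_def field_simps)
    then show ?thesis using periodic[OF I] by metis
  qed
  \<comment> \<open>Otherwise \<open>q\<close> would divide \<open>p\<close>, which is impossible
    for coprime \<open>p\<close> and \<open>q > 1\<close>.\<close>
  have \<beta>: "cos \<beta> \<noteq> 1"
  proof
    assume "cos \<beta> = 1"
    then obtain n :: int where "\<beta> = of_int n * 2 * pi" unfolding cos_one_2pi_int by blast
    then have "real p = of_int n * real q" using q by (simp add: \<beta>_def field_simps)
    then have "of_int (int p) = (of_int (n * int q) :: real)" by simp
    then have "int p = n * int q" unfolding of_int_eq_iff .
    then have "int q dvd int p" by simp
    then have "q dvd p" by simp
    then have "q dvd 1" using cop coprime_absorb_right by blast
    then show False using q by simp
  qed
  have cP: "continuous_on UNIV (\<lambda>x. P (v + c * x))" for v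
    unfolding P_def dX by (intro continuous_intros cX) (use frequency_pos[OF I] in auto)
  have cw: "continuous_on UNIV (\<lambda>x. deriv (X I) (v + c * x))" for v
    unfolding dX by (intro continuous_intros cX) (use frequency_pos[OF I] in auto)
  have "integral {0..T} (\<lambda>\<phi>. F1 p1 p2 p3 X Y I (v + c * \<phi>) \<phi>) = integral {0..T} (\<lambda>\<phi>. P (c * \<phi>))" for v
  proof -
    have i1: "(\<lambda>\<phi>. P (v + c * \<phi>)) integrable_on {0..T}"
      using cP by (meson continuous_on_subset integrable_continuous_interval subset_UNIV)
    have "continuous_on UNIV (\<lambda>\<phi>. sin \<phi> * deriv (X I) (v + c * \<phi>))"
      by (intro continuous_intros cw)
    then have i2: "(\<lambda>\<phi>. sin \<phi> * deriv (X I) (v + c * \<phi>)) integrable_on {0..T}"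
      by (meson continuous_on_subset integrable_continuous_interval subset_UNIV)
    have "integral {0..T} (\<lambda>\<phi>. F1 p1 p2 p3 X Y I (v + c * \<phi>) \<phi>) =
        integral {0..T} (\<lambda>\<phi>. P (v + c * \<phi>) + p3 * (sin \<phi> * deriv (X I) (v + c * \<phi>)))"
      by (simp add: F1_def P_def algebra_simps)
    also have "\<dots> = integral {0..T} (\<lambda>\<phi>. P (v + c * \<phi>)) +
        p3 * integral {0..T} (\<lambda>\<phi>. sin \<phi> * deriv (X I) (v + c * \<phi>))"
      using i1 i2 by (simp add: integral_add integrable_on_mult_right)
    also have "integral {0..T} (\<lambda>\<phi>. sin \<phi> * deriv (X I) (v + c * \<phi>)) = 0"
    proof (rule integral_sin_periodic_eq_0[where \<beta> = \<beta>])
      show "sin T = 0" "cos T = 1" unfolding T_def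
        using sin_npi[of "2 * p"] cos_npi[of "2 * p"] by (simp_all add: algebra_simps)
    qed (use cw T \<beta> per per' in \<open>simp_all add: dX\<close>)
    \<comment> \<open>The phase \<open>v\<close> is rewritten as a shift of \<phi> by
      \<open>v / c\<close>.\<close>
    also have "integral {0..T} (\<lambda>\<phi>. P (v + c * \<phi>)) = integral {0..T} (\<lambda>\<phi>. P (0 + c * (\<phi> + v / c)))"
      using c by (simp add: algebra_simps)
    also have "\<dots> = integral {0..T} (\<lambda>\<phi>. P (0 + c * \<phi>))"
      by (rule integral_periodic_shift[OF cP _ T]) (simp only: P_def dX per)
    finally show ?thesis by simp
  qed
  then show ?thesis by (simp only: A0_def c_def T_def)
qed

text \<open>A constant function has derivative 0 and hence no simple root, which leaves only
  \<open>q = 1\<close>.\<close>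

lemma splittable_imp_main_resonance:
  assumes I: "I \<in> J" and "splittable_resonance p1 p2 p3 p4 h X Y I"
  obtains p :: nat where "p > 0" "deriv h I = p4 / real p"
proof -
  obtain p q v D where pq: "0 < p" "0 < q" "coprime p q" "deriv h I = real q / real p * p4"
    and D: "D \<noteq> 0" "(A0 p1 p2 p3 X Y p q I has_real_derivative D) (at v)"
    using assms(2)
    by (auto simp: splittable_resonance_def resonant_def simple_root_def frequency_def)
  have "q = 1"
  proof (rule ccontr)
    assume "q \<noteq> 1"
    then have "A0 p1 p2 p3 X Y p q I = (\<lambda>_. A0 p1 p2 p3 X Y p q I 0)"
      using A0_constant[OF I pq(1) _ pq(3)] pq(2) by (intro ext) simp
    then have "(A0 p1 p2 p3 X Y p q I has_real_derivative 0) (at v)"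
      by (metis DERIV_const)
    then show False using D DERIV_unique by blast
  qed
  then show ?thesis using that pq by simp
qed

section \<open>Frequencies on the inner and outer levels\<close>

lemma inner_energy:
  assumes I: "I \<in> J" and r: "r \<noteq> G2"
  shows "0 < sqrt (1 + 4 * h I)" "sqrt (1 + 4 * h I) < 1"
proof -
  have "h I \<in> {- 1 / 4 <..< 0}" using bij_betw_apply[OF energy_bij I] r by (cases r) auto
  then show "0 < sqrt (1 + 4 * h I)" "sqrt (1 + 4 * h I) < 1" by auto
qed

lemma outer_energy:
  assumes I: "I \<in> J" and r: "r = G2"
  shows "0 < h I" "1 < sqrt (1 + 4 * h I)"
  using bij_betw_apply[OF energy_bij I] r by auto

text \<open>The curve \<open>(\<sigma> * g \<alpha> / sqrt 2, \<sigma> * s * sin \<alpha> / sqrt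
  2)\<close> runs once through the level, with \<open>g\<close> the speed of \<alpha> in time. The
  second claim names the point where the level crosses the x-axis on the side of the saddle; it
  serves the lower bound on the frequency.\<close>

lemma frequency_inner:
  assumes I: "I \<in> J" and r: "r \<noteq> G2"
  shows "deriv h I * inner_period (sqrt (1 + 4 * h I)) = 2 * pi"
    "\<exists>\<sigma>. \<sigma>\<^sup>2 = 1 \<and> (\<sigma> * sqrt (1 - sqrt (1 + 4 * h I)), 0) \<in> level r (h I)"
proof -
  define s where "s = sqrt (1 + 4 * h I)"
  have s: "0 < s" "s < 1" using inner_energy[OF I r] by (simp_all add: s_def)
  have hI: "h I \<in> energies r" using bij_betw_apply[OF energy_bij I] .
  then have "s\<^sup>2 = 1 + 4 * h I" using r by (cases r) (auto simp: s_def)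
  then have h: "h I = (s\<^sup>2 - 1) / 4" by simp
  \<comment> \<open>The sign selects the right or the left loop.\<close>
  define \<sigma> :: real where "\<sigma> = (if r = G1_plus then 1 else - 1)"
  have \<sigma>: "\<sigma> * \<sigma> = 1" by (simp add: \<sigma>_def)
  have side: "\<sigma> * x \<in> side r" if "x > 0" for x
    using that r by (cases r) (auto simp: \<sigma>_def)
  have H0: "H (\<sigma> * sqrt (1 - s)) 0 = h I"
  proof -
    have "(\<sigma> * sqrt (1 - s))\<^sup>2 = 1 - s" using s \<sigma> by (simp add: power_mult_distrib power2_eq_square[of \<sigma>])
    moreover have "x ^ 4 = (x\<^sup>2)\<^sup>2" for x :: real by simp
    ultimately have "H (\<sigma> * sqrt (1 - s)) 0 = 0\<^sup>2 / 2 - (1 - s) / 2 + (1 - s)\<^sup>2 / 4"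
      by (simp only: H_def)
    then show ?thesis by (simp add: h power2_eq_square field_simps)
  qed
  show "\<exists>\<sigma>. \<sigma>\<^sup>2 = 1 \<and> (\<sigma> * sqrt (1 - sqrt (1 + 4 * h I)), 0) \<in> level r (h I)"
    using H0 hI side[of "sqrt (1 - s)"] s \<sigma>
    by (intro exI[of _ \<sigma>]) (auto simp: level_def region_set_def s_def power2_eq_square)
  define g where "g = (\<lambda>\<alpha>. sqrt (2 * (1 - s * cos \<alpha>)))"
  have pos: "2 * (1 - s * cos \<alpha>) > 0" for \<alpha> using mult_cos_less_1[of s \<alpha>] s by simp
  have g: "g \<alpha> > 0" "(g \<alpha>)\<^sup>2 = 2 * (1 - s * cos \<alpha>)" for \<alpha> using pos[of \<alpha>] by (simp_all add: g_def)
  have dg: "(g has_real_derivative s * sin \<alpha> / g \<alpha>) (at \<alpha>)" for \<alpha>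
    unfolding g_def using pos[of \<alpha>]
    by (auto intro!: derivative_eq_intros simp: divide_simps)
  have "deriv h I * integral {0..2 * pi} (\<lambda>t. 1 / g t) = 2 * pi"
  proof (rule frequency_eq_period[OF I,
        where u = "\<lambda>\<alpha>. \<sigma> * g \<alpha> / sqrt 2" and v = "\<lambda>\<alpha>. \<sigma> * (s * sin \<alpha>) / sqrt 2"])
    show "continuous_on UNIV g" using dg by (auto intro!: continuous_at_imp_continuous_on DERIV_isCont)
    show "g t > 0" for t by (rule g)
    show "((\<lambda>\<alpha>. \<sigma> * g \<alpha> / sqrt 2) has_real_derivative \<sigma> * (s * sin t) / sqrt 2 / g t) (at t)" for t
      using DERIV_cdivide[OF DERIV_cmult[OF dg[of t], of \<sigma>], of "sqrt 2"] by (simp add: mult.commute)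
    have "(\<sigma> * g t / sqrt 2 - (\<sigma> * g t / sqrt 2) ^ 3) / g t = \<sigma> * (s * cos t) / sqrt 2" for t
    proof -
      have "(\<sigma> * g t / sqrt 2)\<^sup>2 = 1 - s * cos t"
        using \<sigma> g(2)[of t] by (simp add: power_mult_distrib power_divide power2_eq_square[of \<sigma>])
      moreover have "x - x ^ 3 = x * (1 - x\<^sup>2)" for x :: real
        by (simp add: power3_eq_cube power2_eq_square right_diff_distrib)
      ultimately have "\<sigma> * g t / sqrt 2 - (\<sigma> * g t / sqrt 2) ^ 3 = \<sigma> * g t / sqrt 2 * (s * cos t)"
        by simp
      also have "\<dots> = \<sigma> * (s * cos t) / sqrt 2 * g t" by (simp add: ac_simps)
      finally have "\<sigma> * g t / sqrt 2 - (\<sigma> * g t / sqrt 2) ^ 3 = \<sigma> * (s * cos t) / sqrt 2 * g t" .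
      then show ?thesis using g(1)[of t] by simp
    qed
    moreover have "((\<lambda>\<alpha>. \<sigma> * (s * sin \<alpha>) / sqrt 2) has_real_derivative \<sigma> * (s * cos t) / sqrt 2) (at t)" for t
      by (intro DERIV_cdivide DERIV_cmult DERIV_sin)
    ultimately show "((\<lambda>\<alpha>. \<sigma> * (s * sin \<alpha>) / sqrt 2) has_real_derivative
        (\<sigma> * g t / sqrt 2 - (\<sigma> * g t / sqrt 2) ^ 3) / g t) (at t)" for t
      by (simp only:)
    show "\<sigma> * g 0 / sqrt 2 \<in> side r" using side[of "g 0 / sqrt 2"] g(1)[of 0] by simp
    show "H (\<sigma> * g 0 / sqrt 2) (\<sigma> * (s * sin 0) / sqrt 2) = h I"
    proof -
      have "g 0 = sqrt 2 * sqrt (1 - s)" by (simp only: g_def real_sqrt_mult cos_zero mult_1_right)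
      then show ?thesis using H0 by simp
    qed
    show "t = 0" if "0 \<le> t" "t < 2 * pi" "\<sigma> * g t / sqrt 2 = \<sigma> * g 0 / sqrt 2" for t
    proof -
      \<comment> \<open>As \<open>s > 0\<close>, the value of \<open>g\<close> determines
        \<open>cos t\<close>, so the position alone detects the first return.\<close>
      have "g t = g 0" using that \<sigma> by auto
      then have "cos t = 1" using g(2)[of t] g(2)[of 0] s by simp
      then show ?thesis using that by (intro cos_eq_1_imp_0)
    qed
  qed (simp_all add: g_def)
  then show "deriv h I * inner_period (sqrt (1 + 4 * h I)) = 2 * pi"
    by (simp only: inner_period_def g_def s_def)
qed

text \<open>The curve \<open>(b * sin \<psi>, b * cos \<psi> * g \<psi>)\<close> runs once through
  the level, with \<open>g\<close> the speed of \<psi> in time.\<close>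

lemma frequency_outer:
  assumes I: "I \<in> J" and r: "r = G2"
  shows "deriv h I * outer_period (sqrt (1 + 4 * h I)) = 2 * pi"
proof -
  define s where "s = sqrt (1 + 4 * h I)"
  have s: "s > 1" using outer_energy[OF I r] by (simp add: s_def)
  have "s\<^sup>2 = 1 + 4 * h I" using outer_energy[OF I r] by (simp add: s_def)
  then have h: "h I = (s\<^sup>2 - 1) / 4" by simp
  \<comment> \<open>\<open>b\<close> is the amplitude: the level meets the x-axis at
    \<open>x = b\<close> and \<open>x = - b\<close>.\<close>
  define b where "b = sqrt (1 + s)"
  have b: "b > 0" "b\<^sup>2 = 1 + s" using s by (simp_all add: b_def)
  define g where "g = (\<lambda>\<psi>. sqrt (((1 + s) * (sin \<psi>)\<^sup>2 + s - 1) / 2))"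
  note pos = outer_radicand_pos[OF s]
  have g: "g \<psi> > 0" "(g \<psi>)\<^sup>2 = ((1 + s) * (sin \<psi>)\<^sup>2 + s - 1) / 2" for \<psi>
    using pos[of \<psi>] by (simp_all only: g_def real_sqrt_gt_zero real_sqrt_pow2 less_imp_le)
  have dg: "(g has_real_derivative (1 + s) * sin \<psi> * cos \<psi> / (2 * g \<psi>)) (at \<psi>)" for \<psi>
  proof -
    have "((\<lambda>\<psi>. ((1 + s) * (sin \<psi>)\<^sup>2 + s - 1) / 2) has_real_derivative (1 + s) * sin \<psi> * cos \<psi>) (at \<psi>)"
      by (auto intro!: derivative_eq_intros)
    from DERIV_chain2[OF DERIV_real_sqrt[OF pos] this] show ?thesis
      by (simp add: g_def field_simps)
  qed
  have "deriv h I * integral {0..2 * pi} (\<lambda>t. 1 / g t) = 2 * pi"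
  proof (rule frequency_eq_period[OF I,
        where u = "\<lambda>\<psi>. b * sin \<psi>" and v = "\<lambda>\<psi>. b * cos \<psi> * g \<psi>"])
    show "continuous_on UNIV g" using dg by (auto intro!: continuous_at_imp_continuous_on DERIV_isCont)
    show "g t > 0" for t by (rule g)
    show "((\<lambda>\<psi>. b * sin \<psi>) has_real_derivative b * cos t * g t / g t) (at t)" for t
      using g(1)[of t] by (auto intro!: derivative_eq_intros)
    have "b * cos t * ((1 + s) * sin t * cos t / (2 * g t)) - b * sin t * g t = (b * sin t - (b * sin t) ^ 3) / g t" for t
    proof -
      have c: "(cos t)\<^sup>2 = 1 - (sin t)\<^sup>2" by (simp add: cos_squared_eq)
      have "b * cos t * ((1 + s) * sin t * cos t / (2 * g t)) - b * sin t * g t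
          = b * sin t * ((1 + s) * (cos t)\<^sup>2 / 2 - (g t)\<^sup>2) / g t"
        using g(1)[of t] by (simp add: field_simps power2_eq_square)
      also have "(1 + s) * (cos t)\<^sup>2 / 2 - (g t)\<^sup>2 = 1 - b\<^sup>2 * (sin t)\<^sup>2"
        unfolding g(2) b(2) c by (simp add: field_simps)
      also have "b * sin t * (1 - b\<^sup>2 * (sin t)\<^sup>2) = b * sin t - (b * sin t) ^ 3"
        by (simp add: algebra_simps power2_eq_square power3_eq_cube)
      finally show ?thesis .
    qed
    moreover have "((\<lambda>\<psi>. b * cos \<psi> * g \<psi>) has_real_derivative
        b * cos t * ((1 + s) * sin t * cos t / (2 * g t)) - b * sin t * g t) (at t)" for t
      by (rule derivative_eq_intros dg refl)+ simp
    ultimately show "((\<lambda>\<psi>. b * cos \<psi> * g \<psi>) has_real_derivative (b * sin t - (b * sin t) ^ 3) / g t) (at t)" for t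
      by (simp only:)
    show "b * sin 0 \<in> side r" using r by simp
    have "(b * g 0)\<^sup>2 = (s\<^sup>2 - 1) / 2"
      unfolding power_mult_distrib g(2) b(2) by (simp add: field_simps power2_eq_square)
    then show "H (b * sin 0) (b * cos 0 * g 0) = h I" by (simp add: H_def h)
    show "t = 0" if "0 \<le> t" "t < 2 * pi" "b * sin t = b * sin 0" "b * cos t * g t = b * cos 0 * g 0" for t
    proof -
      \<comment> \<open>This still admits \<pi>, where the position is the same; the sign of the
        velocity rules it out.\<close>
      have sin: "sin t = 0" using that b by simp
      then have "cos t = 1 \<or> cos t = - 1" by (metis cos_squared_eq diff_zero power2_eq_1_iff zero_power2)
      moreover have "cos t > 0"
      proof -
        have "b * cos t * g t > 0" unfolding that(4) using b g(1)[of 0] by simp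
        then show ?thesis using b(1) g(1)[of t] by (simp add: zero_less_mult_iff)
      qed
      ultimately have "cos t = 1" by auto
      then show ?thesis using that by (intro cos_eq_1_imp_0)
    qed
  qed (simp_all add: g_def)
  then show ?thesis by (simp only: outer_period_def g_def s_def)
qed

section \<open>Monotone frequency, its lower bound, and finiteness\<close>

text \<open>Frequency times period is \<open>2 * pi\<close>, and the period is strictly monotone in
  \<open>s\<close>, increasing on the inner levels and decreasing on the outer ones.\<close>

lemma frequency_inj: "inj_on (deriv h) J"
proof (rule inj_onI)
  fix I I' assume I: "I \<in> J" "I' \<in> J" and eq: "deriv h I = deriv h I'"
  let ?s = "\<lambda>I. sqrt (1 + 4 * h I)"
  note w = frequency_pos[OF I(1)] frequency_pos[OF I(2)]
  have "?s I = ?s I'"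
  proof (cases "r = G2")
    case True
    have "deriv h I * outer_period (?s I) = deriv h I * outer_period (?s I')"
      using frequency_outer[OF I(1) True] frequency_outer[OF I(2) True] eq by simp
    then have "outer_period (?s I) = outer_period (?s I')" using w by simp
    then show ?thesis
      using outer_period_strict_antimono outer_energy(2)[OF I(1) True] outer_energy(2)[OF I(2) True]
      by (metis less_irrefl linorder_neqE_linordered_idom)
  next
    case False
    have "deriv h I * inner_period (?s I) = deriv h I * inner_period (?s I')"
      using frequency_inner(1)[OF I(1) False] frequency_inner(1)[OF I(2) False] eq by simp
    then have "inner_period (?s I) = inner_period (?s I')" using w by simp
    then show ?thesis
      using inner_period_strict_mono inner_energy[OF I(1) False] inner_energy[OF I(2) False]
      by (metis less_irrefl less_imp_le linorder_neqE_linordered_idom)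
  qed
  then have "h I = h I'" by simp
  then show "I = I'" using bij_betw_imp_inj_on[OF energy_bij] I by (auto dest: inj_onD)
qed

text \<open>Missing a ball about the saddle keeps \<open>s\<close> away from 1, so the speed
  \<open>g\<close> of the parameter is at least a constant \<open>c\<close> depending only on
  \<rho>. The period is then at most \<open>2 * pi / c\<close>.\<close>

lemma frequency_bounded_below:
  assumes \<rho>: "\<rho> > 0"
  obtains c where "c > 0"
    "\<And>I. \<lbrakk>I \<in> J; level r (h I) \<inter> ball (0, 0) \<rho> = {}\<rbrakk> \<Longrightarrow> c \<le> deriv h I"
proof -
  have bound: "c \<le> deriv h I"
    if "I \<in> J" "c > 0" "continuous_on {0..2 * pi} g" "\<And>t. g t \<ge> c"
      "deriv h I * integral {0..2 * pi} (\<lambda>t. 1 / g t) = 2 * pi" for I c g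
  proof -
    have "deriv h I * integral {0..2 * pi} (\<lambda>t. 1 / g t) \<le> deriv h I * (2 * pi / c)"
      using integral_inverse_le[OF that(3,4,2)] frequency_pos[OF that(1)] by (intro mult_left_mono) auto
    then have "2 * pi \<le> deriv h I * (2 * pi / c)" by (simp only: that(5))
    then show ?thesis using that(2) by (simp add: field_simps)
  qed
  show ?thesis
  proof (cases "r = G2")
    case True
    \<comment> \<open>The constant comes from the point \<open>(0, sqrt (2 * h I))\<close> of the
      level: outside the ball it forces \<open>2 * h I >= \<rho>^2\<close>, hence
      \<open>s >= sqrt (1 + 2 * \<rho>^2)\<close>, while the radicand is at least
      \<open>(s - 1) / 2\<close>.\<close>
    define c where "c = sqrt ((sqrt (1 + 2 * \<rho>\<^sup>2) - 1) / 2)"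
    show ?thesis
    proof
      have "sqrt (1 + 2 * \<rho>\<^sup>2) > sqrt 1" using \<rho> by (intro real_sqrt_less_mono) simp
      then show c: "c > 0" by (simp add: c_def)
      fix I assume I: "I \<in> J" and far: "level r (h I) \<inter> ball (0, 0) \<rho> = {}"
      define s where "s = sqrt (1 + 4 * h I)"
      note hI = outer_energy[OF I True]
      have "(0, sqrt (2 * h I)) \<in> level r (h I)"
        using hI True by (simp add: level_def region_set_def H_def)
      then have "(0, sqrt (2 * h I)) \<notin> ball ((0 :: real), (0 :: real)) \<rho>" using far by blast
      then have "\<rho> \<le> sqrt (2 * h I)" using hI by (simp add: dist_prod_def dist_real_def)
      then have "\<rho>\<^sup>2 \<le> (sqrt (2 * h I))\<^sup>2" using \<rho> by (intro power_mono) auto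
      then have "\<rho>\<^sup>2 \<le> 2 * h I" using hI by simp
      then have "sqrt (1 + 2 * \<rho>\<^sup>2) \<le> s" unfolding s_def by simp
      then have "(sqrt (1 + 2 * \<rho>\<^sup>2) - 1) / 2 \<le> ((1 + s) * (sin \<psi>)\<^sup>2 + s - 1) / 2" for \<psi>
        using hI(2) by (intro order_trans[OF _ outer_radicand_ge]) (simp_all add: s_def)
      then have "c \<le> sqrt (((1 + s) * (sin \<psi>)\<^sup>2 + s - 1) / 2)" for \<psi>
        unfolding c_def real_sqrt_le_iff .
      then show "c \<le> deriv h I"
        by (intro bound[OF I c _ _ frequency_outer[OF I True, folded s_def, unfolded outer_period_def]]
            continuous_intros) auto
    qed
  next
    case False
    show ?thesis
    \<comment> \<open>Inside the loops \<rho> itself serves: the crossing point outside the ball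
      gives \<open>\<rho> <= sqrt (1 - s)\<close>, and the speed is at least
      \<open>sqrt (1 - s)\<close>.\<close>
    proof (rule that[OF \<rho>])
      fix I assume I: "I \<in> J" and far: "level r (h I) \<inter> ball (0, 0) \<rho> = {}"
      define s where "s = sqrt (1 + 4 * h I)"
      have s: "0 < s" "s < 1" using inner_energy[OF I False] by (simp_all add: s_def)
      obtain \<sigma> where \<sigma>: "\<sigma>\<^sup>2 = 1" "(\<sigma> * sqrt (1 - s), 0) \<in> level r (h I)"
        using frequency_inner(2)[OF I False] unfolding s_def by blast
      then have "(\<sigma> * sqrt (1 - s), 0) \<notin> ball ((0 :: real), (0 :: real)) \<rho>" using far by blast
      moreover have "\<bar>\<sigma>\<bar> = 1" using \<sigma>(1) by (auto simp: power2_eq_1_iff)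
      ultimately have \<rho>s: "\<rho> \<le> sqrt (1 - s)" using s by (simp add: dist_prod_def dist_real_def abs_mult)
      have "\<rho> \<le> sqrt (2 * (1 - s * cos \<alpha>))" for \<alpha>
      proof -
        have "1 - s \<le> 2 * (1 - s)" using s by simp
        also have "\<dots> \<le> 2 * (1 - s * cos \<alpha>)"
          using s by (intro mult_left_mono diff_left_mono mult_left_le) auto
        finally have "1 - s \<le> 2 * (1 - s * cos \<alpha>)" .
        then show ?thesis using \<rho>s by (meson order_trans real_sqrt_le_mono)
      qed
      then show "\<rho> \<le> deriv h I"
        by (intro bound[OF I \<rho> _ _ frequency_inner(1)[OF I False, folded s_def, unfolded inner_period_def]]
            continuous_intros)
    qed
  qed
qed

text \<open>A frequency \<open>p4 / p\<close> that is at least \<open>c\<close> bounds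
  \<open>p\<close>; injectivity of the frequency turns finitely many values into finitely many
  actions.\<close>

lemma finite_splittable_levels:
  assumes \<rho>: "\<rho> > 0" and p4: "p4 > 0"
  shows "finite {I \<in> J. level r (h I) \<inter> ball (0, 0) \<rho> = {} \<and> splittable_resonance p1 p2 p3 p4 h X Y I}"
    (is "finite ?S")
proof -
  obtain c where c: "c > 0"
    "\<And>I. \<lbrakk>I \<in> J; level r (h I) \<inter> ball (0, 0) \<rho> = {}\<rbrakk> \<Longrightarrow> c \<le> deriv h I"
    using frequency_bounded_below[OF \<rho>] by blast
  have "deriv h ` ?S \<subseteq> (\<lambda>p. p4 / real p) ` {..nat \<lceil>p4 / c\<rceil>}"
  proof (rule image_subsetI)
    fix I assume I: "I \<in> ?S"
    then obtain p :: nat where p: "p > 0" "deriv h I = p4 / real p"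
      using splittable_imp_main_resonance by blast
    have "c \<le> p4 / real p" using c(2)[of I] I unfolding p(2) by simp
    then have "real p \<le> p4 / c" using p c(1) by (simp add: field_simps)
    then have "p \<le> nat \<lceil>p4 / c\<rceil>" by linarith
    then show "deriv h I \<in> (\<lambda>p. p4 / real p) ` {..nat \<lceil>p4 / c\<rceil>}" using p by auto
  qed
  then have "finite (deriv h ` ?S)" by (rule finite_subset) simp
  moreover have "inj_on (deriv h) ?S" using frequency_inj by (rule inj_on_subset) auto
  ultimately show ?thesis by (rule finite_imageD)
qed

end

theorem theorem3:
  fixes p1 p2 p3 p4 :: real
    and J :: "region \<Rightarrow> real set"
    and h :: "region \<Rightarrow> real \<Rightarrow> real"
    and X Y :: "region \<Rightarrow> real \<Rightarrow> real \<Rightarrow> real"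
    and N0 V :: "(real \<times> real) set"
    and N :: "region \<Rightarrow> real \<Rightarrow> (real \<times> real) set"
  assumes p3: "p3 \<noteq> 0"
    and p4: "p4 > 0"
    and coords: "\<And>r. action_angle r (J r) (h r) (X r) (Y r)"
    and N0: "nbhd_of figure_eight N0"
    and N: "\<And>r I. \<lbrakk>I \<in> J r; generating_function p1 p2 (X r) (Y r) I = 0\<rbrakk>
              \<Longrightarrow> nbhd_of (level r (h r I)) (N r I)"
    and V: "V = (\<Union>r. region_set r) - N0
              - (\<Union>r. \<Union>I \<in> {I \<in> J r. generating_function p1 p2 (X r) (Y r) I = 0}. N r I)"
  shows "finite {C. \<exists>r. \<exists>I \<in> J r. C = level r (h r I) \<and> C \<subseteq> V \<and>
                     splittable_resonance p1 p2 p3 p4 (h r) (X r) (Y r) I}"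
proof -
  \<comment> \<open>The saddle lies on the figure-eight, so \<open>N0\<close> contains a ball about
    it, and every level inside \<open>V\<close> avoids that ball.\<close>
  have "(0, 0) \<in> figure_eight" by (simp add: figure_eight_def H_def)
  then have "(0, 0) \<in> interior N0" using N0 by (auto simp: nbhd_of_def)
  then obtain \<rho> where \<rho>: "\<rho> > 0" "ball (0, 0) \<rho> \<subseteq> N0" by (auto simp: mem_interior)
  define S where "S = (\<lambda>r. {I \<in> J r. level r (h r I) \<inter> ball (0, 0) \<rho> = {} \<and>
    splittable_resonance p1 p2 p3 p4 (h r) (X r) (Y r) I})"
  have "finite (S r)" for r
    unfolding S_def by (rule action_angle.finite_splittable_levels[OF coords \<rho>(1) p4])
  moreover have "(UNIV :: region set) = {G1_plus, G1_minus, G2}"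
    using region.exhaust by auto
  then have "finite (UNIV :: region set)" by (metis finite.emptyI finite_insert)
  ultimately have "finite (\<Union>r. (\<lambda>I. level r (h r I)) ` S r)" by blast
  then show ?thesis
  proof (rule finite_subset[rotated], intro subsetI)
    fix C assume "C \<in> {C. \<exists>r. \<exists>I \<in> J r. C = level r (h r I) \<and> C \<subseteq> V \<and>
                     splittable_resonance p1 p2 p3 p4 (h r) (X r) (Y r) I}"
    then obtain r I where I: "I \<in> J r" "C = level r (h r I)" "C \<subseteq> V"
      "splittable_resonance p1 p2 p3 p4 (h r) (X r) (Y r) I" by blast
    then have "level r (h r I) \<inter> ball (0, 0) \<rho> = {}" using V \<rho>(2) by blast
    then show "C \<in> (\<Union>r. (\<lambda>I. level r (h r I)) ` S r)" using I by (auto simp: S_def)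
  qed
qed

end
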